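(* Let $G$ and $H$ be finite simple graphs containing no isolated vertices. Then \[ \gamma_{pr}(G)\,\gamma_{pr}(H) \le 6\,\gamma_{pr}(G\Box H). \]
   Context: All graphs are finite, simple and undirected. For a graph $G$ and vertex $v$, $N_G[v]$ denotes the closed neighborhood of $v$. A dominating set of $G$ is a set $D\subseteq V(G)$ with $N_G[v]\cap D\neq\emptyset$ for all $v$. A paired dominating set is a dominating set $D$ such that the induced subgraph $G[D]$ has a perfect matching; $\gamma_{pr}(G)$ is the minimum size of a paired dominating set (which exists when $G$ has no isolated vertices). The Cartesian product $G\Box H$ has vertex set $V(G)\times V(H)$, with $gh$ and $g'h'$ adjacent iff either $g=g'$ and $hh'\in E(H)$, or $h=h'$ and $gg'\in E(G)$. *)

theory Defs
  imports "Graph_Theory.Graph_Theory"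
begin

text \<open>
  Finite simple undirected graphs are the symmetric loop-free digraphs of \<^locale>\<open>pair_graph\<close>, in which
  each undirected edge is represented by its two opposite arcs. Edges are turned back into
  two-element vertex sets where they are counted once, namely in matchings.
\<close>

definition isolated_vertex :: "('a, 'b) pre_digraph \<Rightarrow> 'a \<Rightarrow> bool" where
  "isolated_vertex G v \<longleftrightarrow> v \<in> verts G \<and> \<not> (\<exists>u. v \<rightarrow>\<^bsub>G\<^esub> u)"

definition closed_neighborhood :: "('a, 'b) pre_digraph \<Rightarrow> 'a \<Rightarrow> 'a set" where
  "closed_neighborhood G v = insert v {u. v \<rightarrow>\<^bsub>G\<^esub> u}"

definition dominating_set :: "('a, 'b) pre_digraph \<Rightarrow> 'a set \<Rightarrow> bool" where
  "dominating_set G D \<longleftrightarrow>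
     D \<subseteq> verts G \<and> (\<forall>v\<in>verts G. closed_neighborhood G v \<inter> D \<noteq> {})"

definition undirected_edges :: "('a, 'b) pre_digraph \<Rightarrow> 'a set set" where
  "undirected_edges G = {{u, v} | u v. u \<rightarrow>\<^bsub>G\<^esub> v}"

definition matching :: "('a, 'b) pre_digraph \<Rightarrow> 'a set set \<Rightarrow> bool" where
  "matching G M \<longleftrightarrow> M \<subseteq> undirected_edges G \<and> pairwise disjnt M"

definition perfect_matching :: "('a, 'b) pre_digraph \<Rightarrow> 'a set set \<Rightarrow> bool" where
  "perfect_matching G M \<longleftrightarrow> matching G M \<and> \<Union>M = verts G"

definition paired_dominating_set :: "('a, 'b) pre_digraph \<Rightarrow> 'a set \<Rightarrow> bool" where
  "paired_dominating_set G D \<longleftrightarrow>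
     dominating_set G D \<and> (\<exists>M. perfect_matching (G \<restriction> D) M)"

text \<open>Only meaningful for finite graphs without isolated vertices; see
  \<open>paired_dominating_set_exists\<close> below.\<close>

definition paired_domination_number :: "('a, 'b) pre_digraph \<Rightarrow> nat" where
  "paired_domination_number G = (LEAST k. \<exists>D. paired_dominating_set G D \<and> card D = k)"

definition cartesian_product ::
    "'a pair_pre_digraph \<Rightarrow> 'b pair_pre_digraph \<Rightarrow> ('a \<times> 'b) pair_pre_digraph" where
  "cartesian_product G H =
     \<lparr> pverts = pverts G \<times> pverts H,
       parcs = {((g, h), (g', h')) | g h g' h'.
         g \<in> pverts G \<and> g' \<in> pverts G \<and> h \<in> pverts H \<and> h' \<in> pverts H \<and>
         (g = g' \<and> (h, h') \<in> parcs H \<or> h = h' \<and> (g, g') \<in> parcs G)} \<rparr>"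

lemma pair_graph_cartesian_product:
  assumes "pair_graph G" "pair_graph H"
  shows "pair_graph (cartesian_product G H)"
proof -
  interpret G: pair_graph G by fact
  interpret H: pair_graph H by fact
  have fin: "finite (pverts G \<times> pverts H)"
    using G.pair_finite_verts H.pair_finite_verts by simp
  have sub: "parcs (cartesian_product G H) \<subseteq> (pverts G \<times> pverts H) \<times> (pverts G \<times> pverts H)"
    by (auto simp: cartesian_product_def)
  have symG: "(u, v) \<in> parcs G \<Longrightarrow> (v, u) \<in> parcs G" for u v
    using G.pair_sym_arcs by (auto simp: symmetric_def sym_def)
  have symH: "(u, v) \<in> parcs H \<Longrightarrow> (v, u) \<in> parcs H" for u v
    using H.pair_sym_arcs by (auto simp: symmetric_def sym_def)
  show ?thesis
  proof
    show "finite (pverts (cartesian_product G H))"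
      using fin by (simp add: cartesian_product_def)
    show "finite (parcs (cartesian_product G H))"
      using sub fin by (meson finite_SigmaI finite_subset)
    show "symmetric (with_proj (cartesian_product G H))"
      by (auto simp: symmetric_def sym_def cartesian_product_def intro: symG symH)
  qed (auto simp: cartesian_product_def dest: G.pair_no_loops H.pair_no_loops)
qed

lemma no_isolated_vertex_cartesian_product:
  assumes "pair_graph G" "pair_graph H" "\<not> (\<exists>v. isolated_vertex (with_proj G) v)"
  shows "\<not> (\<exists>v. isolated_vertex (with_proj (cartesian_product G H)) v)"
proof -
  interpret G: pair_graph G by fact
  have "\<exists>g'. (g, g') \<in> parcs G \<and> g' \<in> pverts G" if "g \<in> pverts G" for g
    using that assms(3) by (auto simp: isolated_vertex_def dest: G.in_arcsD2)
  then show ?thesis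
    by (fastforce simp: isolated_vertex_def cartesian_product_def)
qed

lemma paired_dominating_set_exists:
  assumes "graph G" "\<not> (\<exists>v. isolated_vertex G v)"
  shows "\<exists>D. paired_dominating_set G D"
proof -
  interpret graph G by fact
  have sub: "undirected_edges G \<subseteq> Pow (verts G)"
    by (auto simp: undirected_edges_def arcs_ends_conv)
  have "finite {M. matching G M}"
    by (rule finite_subset[of _ "Pow (Pow (verts G))"])
      (use sub in \<open>auto simp: matching_def\<close>)
  moreover have "{} \<in> {M. matching G M}" by (simp add: matching_def)
  ultimately obtain M where M: "matching G M"
    and max: "\<And>N. matching G N \<Longrightarrow> M \<subseteq> N \<Longrightarrow> N = M"
    using finite_has_maximal[of "{M. matching G M}"] by (metis empty_iff mem_Collect_eq)
  have Msub: "\<Union>M \<subseteq> verts G" using M sub by (auto simp: matching_def)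
  have "dominating_set G (\<Union>M)"
    unfolding dominating_set_def
  proof (intro conjI ballI Msub notI)
    fix v assume v: "v \<in> verts G" and e: "closed_neighborhood G v \<inter> \<Union>M = {}"
    obtain u where u: "v \<rightarrow>\<^bsub>G\<^esub> u" using assms(2) v by (auto simp: isolated_vertex_def)
    with e have nin: "v \<notin> \<Union>M" "u \<notin> \<Union>M" by (auto simp: closed_neighborhood_def)
    have "matching G (insert {v, u} M)"
      using M u nin by (auto simp: matching_def undirected_edges_def pairwise_insert disjnt_def)
    with max have "{v, u} \<in> M" by blast
    with nin show False by blast
  qed
  moreover have "M \<subseteq> undirected_edges (G \<restriction> \<Union>M)"
  proof
    fix e assume e: "e \<in> M"
    then obtain u v where uv: "e = {u, v}" "u \<rightarrow>\<^bsub>G\<^esub> v"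
      using M by (auto simp: matching_def undirected_edges_def)
    with e have "u \<in> \<Union>M" "v \<in> \<Union>M" by auto
    with uv(2) have "u \<rightarrow>\<^bsub>G \<restriction> \<Union>M\<^esub> v" by (fastforce simp: arcs_ends_conv)
    with uv(1) show "e \<in> undirected_edges (G \<restriction> \<Union>M)" by (auto simp: undirected_edges_def)
  qed
  ultimately show ?thesis
    using M by (auto simp: paired_dominating_set_def perfect_matching_def matching_def)
qed

end

theory Submission
  imports Defs
begin

text \<open>
  In a graph without isolated vertices \<open>\<gamma>\<^sub>p\<^sub>r\<close> is twice the least number of edges whose endpoints
  dominate: overlapping edges can be replaced greedily by disjoint ones without losing domination.
  This removes the matching condition, and the Clark--Suen double count applies. Fix \<open>k\<close> edges of
  \<open>G\<close> with dominating endpoints and a partition of \<open>V(G)\<close> into \<open>k\<close> cells, each dominated by its edge,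
  and project the edges of a paired dominating set of \<open>G \<box> H\<close> to both factors. An edge in the
  direction of a factor projects to an edge there, and its two endpoints have to be
  completed to an edge each in the other factor, so each edge is counted \<open>1 + 2 = 3\<close> times.
\<close>

section \<open>Edge sets with dominating endpoints\<close>

text \<open>Paired domination without the matching condition: the edges may share vertices. An edge
  is recorded by an arc in either orientation, so \<open>card F\<close> is at least the number of
  edges.\<close>

definition arc_dominating :: "'a pair_pre_digraph \<Rightarrow> ('a \<times> 'a) set \<Rightarrow> bool" where
  "arc_dominating G F \<longleftrightarrow>
     F \<subseteq> parcs G \<and> (\<forall>v\<in>pverts G. \<exists>x \<in> fst ` F \<union> snd ` F. x = v \<or> (v, x) \<in> parcs G)"

lemma pair_graph_arc_sym:
  assumes "pair_graph G" "(u, v) \<in> parcs G"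
  shows "(v, u) \<in> parcs G"
proof -
  interpret pair_graph G by fact
  show ?thesis using pair_sym_arcs assms(2) by (auto simp: symmetric_def sym_def)
qed

lemma pair_graph_arc_in_verts:
  assumes "pair_graph G" "(u, v) \<in> parcs G"
  shows "u \<in> pverts G" "v \<in> pverts G"
proof -
  interpret pair_graph G by fact
  show "u \<in> pverts G" "v \<in> pverts G" using assms(2) by (auto dest: in_arcsD1 in_arcsD2)
qed

section \<open>Matchings and the paired domination number\<close>

lemma undirected_edges_with_proj:
  "undirected_edges (with_proj G) = {{u, v} | u v. (u, v) \<in> parcs G}"
  by (simp add: undirected_edges_def)

text \<open>The disjunction says that all closed neighbours of \<open>x\<close> are dominated by \<open>\<Union>M\<close>, provided that
  \<open>x\<close> is not isolated.\<close>

lemma matching_covering_arcs: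
  assumes "finite F" "F \<subseteq> parcs G"
  shows "\<exists>M. matching (with_proj G) M \<and> finite M \<and> card M \<le> card F \<and>
    (\<forall>x \<in> fst ` F \<union> snd ` F. x \<in> \<Union>M \<or> (\<forall>y. (x, y) \<in> parcs G \<longrightarrow> y \<in> \<Union>M))"
  using assms
proof (induction F rule: finite_induct)
  case empty
  show ?case by (intro exI[of _ "{}"]) (simp add: matching_def)
next
  case (insert e F)
  let ?ok = "\<lambda>M x. x \<in> \<Union>M \<or> (\<forall>y. (x, y) \<in> parcs G \<longrightarrow> y \<in> \<Union>M)"
  obtain u v where e: "e = (u, v)" by fastforce
  with insert.prems have uv: "(u, v) \<in> parcs G" by simp
  from insert obtain M where M: "matching (with_proj G) M" "finite M" "card M \<le> card F"
    and ok: "\<forall>x \<in> fst ` F \<union> snd ` F. ?ok M x"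
    by auto
  \<comment> \<open>\<open>?ok\<close> survives enlarging \<open>M\<close>, so one new edge disjoint
    from \<open>M\<close> suffices if it settles both endpoints of \<open>e\<close>.\<close>
  have extend: ?case
    if "(a, b) \<in> parcs G" "a \<notin> \<Union>M" "b \<notin> \<Union>M"
      "\<And>x. x \<in> {u, v} \<Longrightarrow> x \<in> {a, b} \<or> ?ok M x" for a b
  proof (intro exI[of _ "insert {a, b} M"] conjI)
    show "matching (with_proj G) (insert {a, b} M)"
      using M(1) that(1-3)
      by (auto simp: matching_def undirected_edges_with_proj pairwise_insert disjnt_def)
    show "finite (insert {a, b} M)" using M(2) by simp
    show "card (insert {a, b} M) \<le> card (insert e F)"
      using M(2,3) insert.hyps by (simp add: card_insert_if)
    show "\<forall>x \<in> fst ` insert e F \<union> snd ` insert e F. ?ok (insert {a, b} M) x"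
    proof
      fix x assume "x \<in> fst ` insert e F \<union> snd ` insert e F"
      then have "x \<in> {u, v} \<or> x \<in> fst ` F \<union> snd ` F" using e by auto
      then have "x \<in> {a, b} \<or> ?ok M x" using ok that(4) by blast
      then show "?ok (insert {a, b} M) x" by auto
    qed
  qed
  consider "?ok M u" "?ok M v" | "\<not> ?ok M u" "\<not> ?ok M v" | "\<not> ?ok M u" "?ok M v"
    | "?ok M u" "\<not> ?ok M v" by argo
  then show ?case
  proof cases
    case 1
    then show ?thesis
      using M ok e insert.hyps by (intro exI[of _ M]) auto
  next
    case 2
    then show ?thesis using uv by (intro extend[of u v]) auto
  next
    case 3
    \<comment> \<open>Failure of \<open>?ok\<close> at \<open>u\<close> means that \<open>u\<close>
      and some neighbour \<open>w\<close> are both uncovered, so \<open>{u, w}\<close> can join the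
      matching.\<close>
    then obtain w where "(u, w) \<in> parcs G" "w \<notin> \<Union>M" by auto
    with 3 show ?thesis by (intro extend[of u w]) auto
  next
    case 4
    then obtain w where "(v, w) \<in> parcs G" "w \<notin> \<Union>M" by auto
    with 4 show ?thesis by (intro extend[of v w]) auto
  qed
qed

lemma paired_dominating_set_Union_matching:
  assumes "pair_graph G" and M: "matching (with_proj G) M"
    and dom: "\<And>v. v \<in> pverts G \<Longrightarrow> \<exists>x\<in>\<Union>M. x = v \<or> (v, x) \<in> parcs G"
  shows "paired_dominating_set (with_proj G) (\<Union>M)"
proof -
  have "\<Union>M \<subseteq> pverts G"
    using M pair_graph_arc_in_verts[OF assms(1)]
    by (fastforce simp: matching_def undirected_edges_with_proj)
  then have "dominating_set (with_proj G) (\<Union>M)"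
    using dom by (fastforce simp: dominating_set_def closed_neighborhood_def)
  moreover have "M \<subseteq> undirected_edges (with_proj G \<restriction> \<Union>M)"
  proof
    fix e assume e: "e \<in> M"
    then obtain u v where uv: "e = {u, v}" "u \<rightarrow>\<^bsub>with_proj G\<^esub> v"
      using M by (auto simp: matching_def undirected_edges_def)
    with e have "u \<in> \<Union>M" "v \<in> \<Union>M" by auto
    with uv(2) have "u \<rightarrow>\<^bsub>with_proj G \<restriction> \<Union>M\<^esub> v" by (fastforce simp: arcs_ends_conv)
    with uv(1) show "e \<in> undirected_edges (with_proj G \<restriction> \<Union>M)"
      by (auto simp: undirected_edges_def)
  qed
  ultimately show ?thesis
    using M by (auto simp: paired_dominating_set_def perfect_matching_def matching_def)
qed

lemma card_Union_matching:
  assumes "pair_graph G" and M: "matching (with_proj G) M"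
  shows "card (\<Union>M) = 2 * card M"
proof -
  interpret pair_graph G by fact
  have two: "card e = 2" if "e \<in> M" for e
    using that M no_loops
    by (auto simp: matching_def undirected_edges_with_proj card_insert_if)
  have "card (\<Union>M) = (\<Sum>e\<in>M. card e)"
  proof (rule card_Union_disjoint)
    show "pairwise disjnt M" using M by (simp add: matching_def)
    \<comment> \<open>Infinite sets have \<open>card\<close> 0, so cardinality 2 forces
      finiteness.\<close>
    show "finite e" if "e \<in> M" for e using two[OF that] card.infinite by fastforce
  qed
  also have "\<dots> = 2 * card M" using two by simp
  finally show ?thesis .
qed

lemma paired_domination_number_le:
  assumes G: "pair_graph G" and F: "arc_dominating G F"
  shows "paired_domination_number (with_proj G) \<le> 2 * card F"
proof -
  interpret pair_graph G by fact
  have sub: "F \<subseteq> parcs G" using F by (simp add: arc_dominating_def)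
  then have "finite F" using pair_finite_arcs by (rule finite_subset)
  from matching_covering_arcs[OF this sub]
  obtain M where M: "matching (with_proj G) M" "card M \<le> card F"
    and ok: "\<forall>x \<in> fst ` F \<union> snd ` F. x \<in> \<Union>M \<or> (\<forall>y. (x, y) \<in> parcs G \<longrightarrow> y \<in> \<Union>M)"
    by (elim exE conjE) (rule that)
  have "paired_dominating_set (with_proj G) (\<Union>M)"
  proof (rule paired_dominating_set_Union_matching[OF G M(1)])
    fix v assume "v \<in> pverts G"
    then obtain x where x: "x \<in> fst ` F \<union> snd ` F" "x = v \<or> (v, x) \<in> parcs G"
      using F unfolding arc_dominating_def by blast
    \<comment> \<open>If \<open>x\<close> is uncovered, all its neighbours are covered. The case
      \<open>v = x\<close> then still needs some neighbour \<open>z\<close> to dominate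
      \<open>v\<close>; a \<open>v\<close> adjacent to \<open>x\<close> is covered itself.\<close>
    have "\<exists>z. (x, z) \<in> parcs G"
      using x(1) sub pair_graph_arc_sym[OF G] by fastforce
    with x(2) bspec[OF ok x(1)] show "\<exists>x\<in>\<Union>M. x = v \<or> (v, x) \<in> parcs G"
      using pair_graph_arc_sym[OF G] by blast
  qed
  then have "paired_domination_number (with_proj G) \<le> card (\<Union>M)"
    unfolding paired_domination_number_def by (auto intro: Least_le)
  then show ?thesis using card_Union_matching[OF G M(1)] M(2) by simp
qed

text \<open>Orient each edge of a perfect matching of a minimum paired dominating set; that such a
  set exists is where the absence of isolated vertices enters.\<close>

lemma paired_domination_number_attained:
  assumes G: "pair_graph G" and iso: "\<not> (\<exists>v. isolated_vertex (with_proj G) v)"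
  shows "\<exists>F. arc_dominating G F \<and> paired_domination_number (with_proj G) = 2 * card F"
proof -
  interpret pair_graph G by fact
  have "graph (with_proj G)" by unfold_locales
  then have "\<exists>k D. paired_dominating_set (with_proj G) D \<and> card D = k"
    using paired_dominating_set_exists iso by blast
  then obtain D where D: "paired_dominating_set (with_proj G) D"
    and card: "card D = paired_domination_number (with_proj G)"
    unfolding paired_domination_number_def by (rule LeastI_ex[THEN exE]) blast
  then obtain M where M: "M \<subseteq> undirected_edges (with_proj G \<restriction> D)" "pairwise disjnt M" "\<Union>M = D"
    by (auto simp: paired_dominating_set_def perfect_matching_def matching_def)
  have "undirected_edges (with_proj G \<restriction> D) \<subseteq> undirected_edges (with_proj G)"
    by (fastforce simp: undirected_edges_def arcs_ends_conv)
  with M have match: "matching (with_proj G) M" by (auto simp: matching_def)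
  then have "\<forall>e\<in>M. \<exists>a. a \<in> parcs G \<and> e = {fst a, snd a}"
    by (fastforce simp: matching_def undirected_edges_with_proj)
  then obtain a where a: "\<And>e. e \<in> M \<Longrightarrow> a e \<in> parcs G"
    "\<And>e. e \<in> M \<Longrightarrow> e = {fst (a e), snd (a e)}" by metis
  have "inj_on a M" by (metis a(2) inj_onI)
  then have "card (a ` M) = card M" by (rule card_image)
  moreover have "fst ` a ` M \<union> snd ` a ` M = D" using a(2) M(3) by blast
  moreover have "\<forall>v\<in>pverts G. \<exists>x\<in>D. x = v \<or> (v, x) \<in> parcs G"
    using D by (fastforce simp: paired_dominating_set_def dominating_set_def closed_neighborhood_def)
  ultimately show ?thesis
    using a(1) card card_Union_matching[OF G match] M(3)
    by (intro exI[of _ "a ` M"]) (auto simp: arc_dominating_def)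
qed

section \<open>Double count on the Cartesian product\<close>

text \<open>Distinct fibers are disjoint; equality can fail because \<open>f\<close> may take values
  outside \<open>I\<close>.\<close>

lemma sum_card_fibers_le:
  assumes "finite X" "finite I"
  shows "(\<Sum>i\<in>I. card {x \<in> X. f x = i}) \<le> card X"
proof -
  have "(\<Sum>i\<in>I. card {x \<in> X. f x = i}) = card (\<Union>i\<in>I. {x \<in> X. f x = i})"
    using assms by (intro card_UN_disjoint[symmetric]) auto
  also have "\<dots> \<le> card X" using assms by (intro card_mono) auto
  finally show ?thesis .
qed

text \<open>The factors are treated asymmetrically: the edges of a minimum \<open>F\<close> index
  the cells of \<open>G\<close>, while \<open>H\<close> enters through the lower bound
  \<open>l\<close>.\<close>

lemma arc_dominating_cartesian_product:
  assumes G: "pair_graph G" and H: "pair_graph H"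
    and isoG: "\<not> (\<exists>v. isolated_vertex (with_proj G) v)"
    and isoH: "\<not> (\<exists>v. isolated_vertex (with_proj H) v)"
    and A: "arc_dominating (cartesian_product G H) A"
    and F: "arc_dominating G F" "\<And>F'. arc_dominating G F' \<Longrightarrow> card F \<le> card F'"
    and l: "\<And>F'. arc_dominating H F' \<Longrightarrow> l \<le> card F'"
  shows "card F * l \<le> 3 * card A"
proof -
  interpret G: pair_graph G by fact
  interpret H: pair_graph H by fact
  interpret P: pair_graph "cartesian_product G H"
    using G H by (rule pair_graph_cartesian_product)
  \<comment> \<open>Split by direction: \<open>AG\<close> holds the arcs along \<open>G\<close>,
    \<open>AH\<close> those along \<open>H\<close>; \<open>VG\<close> and \<open>VH\<close> are
    their endpoints.\<close>
  define AG where "AG = {a \<in> A. fst (fst a) \<noteq> fst (snd a)}"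
  define AH where "AH = {a \<in> A. fst (fst a) = fst (snd a)}"
  define VG where "VG = fst ` AG \<union> snd ` AG"
  define VH where "VH = fst ` AH \<union> snd ` AH"
  have Asub: "A \<subseteq> parcs (cartesian_product G H)" using A by (simp add: arc_dominating_def)
  have finA: "finite A" using Asub P.pair_finite_arcs by (rule finite_subset)
  have fin: "finite AG" "finite AH" "finite VG" "finite VH"
    using finA by (auto simp: AG_def AH_def VG_def VH_def)
  have cardA: "card A = card AG + card AH"
    unfolding AG_def AH_def using finA
    by (subst card_Un_disjoint[symmetric]) (auto intro: arg_cong[where f = card])
  have cardV: "card VG \<le> 2 * card AG" "card VH \<le> 2 * card AH"
    using card_Un_le[of "fst ` AG" "snd ` AG"] card_Un_le[of "fst ` AH" "snd ` AH"]
      card_image_le[OF fin(1), of fst] card_image_le[OF fin(1), of snd]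
      card_image_le[OF fin(2), of fst] card_image_le[OF fin(2), of snd]
    by (simp_all add: VG_def VH_def)
  have "F \<subseteq> parcs G" using F(1) by (simp add: arc_dominating_def)
  then have finF: "finite F" using G.pair_finite_arcs by (rule finite_subset)
  have VAB: "fst ` A \<union> snd ` A = VG \<union> VH" by (auto simp: VG_def VH_def AG_def AH_def)
  have VGH: "x \<in> pverts G" "y \<in> pverts H" if "(x, y) \<in> VG \<union> VH" for x y
    using that Asub unfolding VAB[symmetric] by (auto simp: cartesian_product_def)
  have AGarc: "snd (fst a) = snd (snd a)" "(fst (fst a), fst (snd a)) \<in> parcs G"
    if "a \<in> AG" for a
    using that subsetD[OF Asub, of a] by (auto simp: AG_def cartesian_product_def)
  have AHeq: "fst (fst a) = fst (snd a)" if "a \<in> AH" for a using that by (simp add: AH_def)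
  have AHarc: "(snd (fst a), snd (snd a)) \<in> parcs H" if "a \<in> AH" for a
    using that subsetD[OF Asub, of a]
    by (auto simp: AH_def cartesian_product_def dest: G.pair_no_loops)
  \<comment> \<open>Arbitrary neighbours, used to complete a projected vertex to an arc.\<close>
  obtain nG where nG: "\<And>g. g \<in> pverts G \<Longrightarrow> (g, nG g) \<in> parcs G"
    using isoG by (simp add: isolated_vertex_def) metis
  obtain nH where nH: "\<And>h. h \<in> pverts H \<Longrightarrow> (h, nH h) \<in> parcs H"
    using isoH by (simp add: isolated_vertex_def) metis
  have "\<forall>g\<in>pverts G. \<exists>e\<in>F. \<exists>x\<in>{fst e, snd e}. x = g \<or> (g, x) \<in> parcs G"
    using F(1) by (fastforce simp: arc_dominating_def)
  \<comment> \<open>The fibers of \<open>p\<close> are the cells: \<open>p g\<close> is an edge of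
    \<open>F\<close> with an endpoint in the closed neighbourhood of \<open>g\<close>.\<close>
  then obtain p where p: "\<And>g. g \<in> pverts G \<Longrightarrow> p g \<in> F"
    "\<And>g. g \<in> pverts G \<Longrightarrow> \<exists>x\<in>{fst (p g), snd (p g)}. x = g \<or> (g, x) \<in> parcs G"
    by metis
  \<comment> \<open>\<open>hdom g h\<close>: the vertex \<open>(g, h)\<close> is dominated from
    within its own row \<open>h\<close>. \<open>S e\<close> collects the rows in which this holds on
    the whole cell of \<open>e\<close>.\<close>
  define hdom where "hdom = (\<lambda>g h. \<exists>x. (x, h) \<in> VG \<union> VH \<and> (x = g \<or> (g, x) \<in> parcs G))"
  define S where "S = (\<lambda>e. {h \<in> pverts H. \<forall>g\<in>pverts G. p g = e \<longrightarrow> hdom g h})"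
  have dom: "hdom g h \<or> (\<exists>y. (g, y) \<in> VG \<union> VH \<and> (h, y) \<in> parcs H)"
    if gh: "g \<in> pverts G" "h \<in> pverts H" for g h
  proof -
    have "(g, h) \<in> pverts (cartesian_product G H)" using gh by (simp add: cartesian_product_def)
    then obtain x y where "(x, y) \<in> VG \<union> VH"
      "(x, y) = (g, h) \<or> ((g, h), (x, y)) \<in> parcs (cartesian_product G H)"
      using A unfolding arc_dominating_def VAB by (metis surj_pair)
    then show ?thesis by (auto simp: hdom_def cartesian_product_def)
  qed
  \<comment> \<open>Project the strip over the cell of \<open>e\<close> to \<open>H\<close>. An
    \<open>AH\<close> arc has both ends over the same vertex of \<open>G\<close>, so it stays in the
    strip and costs one. An \<open>AG\<close> arc may leave the strip, so its endpoints are charged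
    separately. Rows in \<open>S e\<close> may lack domination along \<open>H\<close> and are added
    by hand.\<close>
  have column: "l \<le> card {a \<in> AH. p (fst (fst a)) = e} + card {v \<in> VG. p (fst v) = e} + card (S e)"
    if e: "e \<in> F" for e
  proof -
    define T where "T = (\<lambda>a. (snd (fst a), snd (snd a))) ` {a \<in> AH. p (fst (fst a)) = e}"
    define T' where "T' = (\<lambda>v. (snd v, nH (snd v))) ` {v \<in> VG. p (fst v) = e}"
    define T'' where "T'' = (\<lambda>h. (h, nH h)) ` S e"
    have "T \<union> T' \<union> T'' \<subseteq> parcs H"
      using AHarc by (auto simp: T_def T'_def T''_def S_def intro!: nH intro: VGH(2))
    moreover have "\<exists>x \<in> fst ` (T \<union> T' \<union> T'') \<union> snd ` (T \<union> T' \<union> T''). x = h \<or> (h, x) \<in> parcs H"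
      if h: "h \<in> pverts H" for h
    proof (cases "h \<in> S e")
      case True
      then have "h \<in> fst ` T''" by (force simp: T''_def)
      then show ?thesis by blast
    next
      case False
      then obtain g where "g \<in> pverts G" "p g = e" "\<not> hdom g h" using h by (auto simp: S_def)
      with dom h obtain y where y: "(g, y) \<in> VG \<union> VH" "(h, y) \<in> parcs H" by blast
      have "y \<in> fst ` T' \<or> y \<in> fst ` T \<union> snd ` T"
      proof (cases "(g, y) \<in> VG")
        case True
        then show ?thesis using \<open>p g = e\<close> by (force simp: T'_def)
      next
        case False
        with y(1) have "(g, y) \<in> fst ` AH \<union> snd ` AH" by (simp add: VH_def)
        then obtain a where a: "a \<in> AH" "fst a = (g, y) \<or> snd a = (g, y)" by (metis Un_iff imageE)
        then have "p (fst (fst a)) = e" using \<open>p g = e\<close> AHeq[OF a(1)] by (metis fst_conv)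
        with a(1) have "(snd (fst a), snd (snd a)) \<in> T" unfolding T_def by (intro imageI) simp
        moreover have "y = snd (fst a) \<or> y = snd (snd a)" using a(2) by (metis snd_conv)
        ultimately show ?thesis by (auto intro: rev_image_eqI)
      qed
      with y(2) show ?thesis by blast
    qed
    ultimately have "l \<le> card (T \<union> T' \<union> T'')" by (intro l) (auto simp: arc_dominating_def)
    also have "\<dots> \<le> card T + card T' + card T''"
      using card_Un_le[of "T \<union> T'" T''] card_Un_le[of T T'] by simp
    also have "\<dots> \<le> card {a \<in> AH. p (fst (fst a)) = e} + card {v \<in> VG. p (fst v) = e} + card (S e)"
      unfolding T_def T'_def T''_def using fin H.pair_finite_verts
      by (intro add_mono card_image_le) (auto simp: S_def)
    finally show ?thesis .
  qed
  \<comment> \<open>Project row \<open>h\<close> to \<open>G\<close>. Cells dominated within the row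
    need no edge of their own; for the others, the edge of \<open>F\<close> is kept. Minimality of
    \<open>F\<close> then bounds the number of edges saved.\<close>
  have row: "card {e \<in> F. h \<in> S e} \<le> card {a \<in> AG. snd (fst a) = h} + card {v \<in> VH. snd v = h}"
    if h: "h \<in> pverts H" for h
  proof -
    define U where "U = (\<lambda>a. (fst (fst a), fst (snd a))) ` {a \<in> AG. snd (fst a) = h}"
    define U' where "U' = (\<lambda>v. (fst v, nG (fst v))) ` {v \<in> VH. snd v = h}"
    define U'' where "U'' = {e \<in> F. h \<notin> S e}"
    have "U \<union> U' \<union> U'' \<subseteq> parcs G"
      using AGarc \<open>F \<subseteq> parcs G\<close> by (auto simp: U_def U'_def U''_def intro!: nG intro: VGH(1))
    moreover have "\<exists>x \<in> fst ` (U \<union> U' \<union> U'') \<union> snd ` (U \<union> U' \<union> U''). x = g \<or> (g, x) \<in> parcs G"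
      if g: "g \<in> pverts G" for g
    proof (cases "h \<in> S (p g)")
      case True
      then obtain x where x: "(x, h) \<in> VG \<union> VH" "x = g \<or> (g, x) \<in> parcs G"
        using g by (auto simp: S_def hdom_def)
      have "x \<in> fst ` U' \<or> x \<in> fst ` U \<union> snd ` U"
      proof (cases "(x, h) \<in> VH")
        case True
        then show ?thesis by (force simp: U'_def)
      next
        case False
        with x(1) have "(x, h) \<in> fst ` AG \<union> snd ` AG" by (simp add: VG_def)
        then obtain a where a: "a \<in> AG" "fst a = (x, h) \<or> snd a = (x, h)" by (metis Un_iff imageE)
        then have "snd (fst a) = h" using AGarc(1)[OF a(1)] by (metis snd_conv)
        with a(1) have "(fst (fst a), fst (snd a)) \<in> U" unfolding U_def by (intro imageI) simp
        moreover have "x = fst (fst a) \<or> x = fst (snd a)" using a(2) by (metis fst_conv)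
        ultimately show ?thesis by (auto intro: rev_image_eqI)
      qed
      with x(2) show ?thesis by blast
    next
      case False
      then have "p g \<in> U''" using p(1) g by (simp add: U''_def)
      with p(2)[OF g] show ?thesis by blast
    qed
    ultimately have "card F \<le> card (U \<union> U' \<union> U'')" by (intro F(2)) (auto simp: arc_dominating_def)
    also have "\<dots> \<le> card U + card U' + card U''"
      using card_Un_le[of "U \<union> U'" U''] card_Un_le[of U U'] by simp
    also have "\<dots> \<le> card {a \<in> AG. snd (fst a) = h} + card {v \<in> VH. snd v = h} + card U''"
      unfolding U_def U'_def using fin by (intro add_mono card_image_le) auto
    finally have "card F \<le> \<dots>" .
    moreover have "card F = card {e \<in> F. h \<in> S e} + card U''"
      unfolding U''_def using finF
      by (subst card_Un_disjoint[symmetric]) (auto intro: arg_cong[where f = card])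
    ultimately show ?thesis by simp
  qed
  \<comment> \<open>Count the pairs \<open>(e, h)\<close> with \<open>h \<in> S e\<close> by rows
    instead of by cells.\<close>
  have "(\<Sum>e\<in>F. card (S e)) = (\<Sum>e\<in>F. \<Sum>h\<in>pverts H. if h \<in> S e then 1 else 0)"
    by (intro sum.cong refl) (auto simp: S_def sum.If_cases intro!: arg_cong[where f = card])
  also have "\<dots> = (\<Sum>h\<in>pverts H. \<Sum>e\<in>F. if h \<in> S e then 1 else 0)" by (rule sum.swap)
  also have "\<dots> = (\<Sum>h\<in>pverts H. card {e \<in> F. h \<in> S e})"
    using finF by (intro sum.cong refl) (auto simp: sum.If_cases intro!: arg_cong[where f = card])
  also have "\<dots> \<le> (\<Sum>h\<in>pverts H. card {a \<in> AG. snd (fst a) = h} + card {v \<in> VH. snd v = h})"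
    by (intro sum_mono row)
  also have "\<dots> \<le> card AG + card VH"
    unfolding sum.distrib using fin H.pair_finite_verts
    by (intro add_mono sum_card_fibers_le) auto
  finally have cardS: "(\<Sum>e\<in>F. card (S e)) \<le> card AG + card VH" .
  have "card F * l = (\<Sum>e\<in>F. l)" by simp
  also have "\<dots> \<le> (\<Sum>e\<in>F. card {a \<in> AH. p (fst (fst a)) = e} + card {v \<in> VG. p (fst v) = e} + card (S e))"
    by (intro sum_mono column)
  also have "\<dots> \<le> card AH + card VG + (card AG + card VH)"
    unfolding sum.distrib using fin finF cardS
    by (intro add_mono sum_card_fibers_le) auto
  \<comment> \<open>Each arc counts once as an arc and at most twice through its endpoints.\<close>
  also have "\<dots> \<le> 3 * card A" using cardA cardV by simp
  finally show ?thesis .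
qed

theorem theorem4:
  fixes G :: "'a pair_pre_digraph" and H :: "'b pair_pre_digraph"
  assumes "pair_graph G" and "pair_graph H"
    and "\<not> (\<exists>v. isolated_vertex (with_proj G) v)"
    and "\<not> (\<exists>v. isolated_vertex (with_proj H) v)"
  shows "paired_domination_number (with_proj G) * paired_domination_number (with_proj H)
    \<le> 6 * paired_domination_number (with_proj (cartesian_product G H))"
proof -
  obtain F where F: "arc_dominating G F" "paired_domination_number (with_proj G) = 2 * card F"
    using paired_domination_number_attained assms(1,3) by blast
  obtain K where K: "arc_dominating H K" "paired_domination_number (with_proj H) = 2 * card K"
    using paired_domination_number_attained assms(2,4) by blast
  obtain A where A: "arc_dominating (cartesian_product G H) A"
    "paired_domination_number (with_proj (cartesian_product G H)) = 2 * card A"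
    using paired_domination_number_attained pair_graph_cartesian_product
      no_isolated_vertex_cartesian_product assms(1-3) by blast
  have "card F * card K \<le> 3 * card A"
  proof (rule arc_dominating_cartesian_product[OF assms A(1) F(1)])
    show "card F \<le> card F'" if "arc_dominating G F'" for F'
      using paired_domination_number_le[OF assms(1) that] F(2) by simp
    show "card K \<le> card F'" if "arc_dominating H F'" for F'
      using paired_domination_number_le[OF assms(2) that] K(2) by simp
  qed
  \<comment> \<open>With every number twice an edge count, the constant is 4 * 3 / 2 = 6.\<close>
  then show ?thesis using F(2) K(2) A(2) by simp
qed

end
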